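(* Let $K\subset\mathbb{R}$ be a regular compact set, let $g$ be the Green function of $\overline{\mathbb{C}}\setminus K$ with pole at infinity, and for $\delta>0$ put $$G(\delta):=\max\{ g(z): z\in\mathbb{C},\ \operatorname{dist}(z,K)\le 2\delta\}.$$ Let $0<\tau\le1$, $n\ge1$, and let $x_0,\ldots,x_{n-1}\in K$ be a $\tau$-quasi Leja sequence. Then for every $\delta>0$, $$\Lambda_n\le \frac{2}{\tau^2}\,n\left[ \frac{\operatorname{diam}(K)}{\tau\delta}\, e^{nG(\delta)}\right]^{9/8+2\lambda^{-1}\log(1/\tau)},$$ where $\lambda=0.24565978\ldots$ is the positive root of the equation $e^{e^\lambda}(e^\lambda-1)=1$.
   Context: A compact set $K\subset\mathbb{C}$ is regular if the Green function $g(z)=g_{\overline{\mathbb{C}}\setminus K}(z,\infty)$ of $\overline{\mathbb{C}}\setminus K$ with pole at infinity is continuous on $\mathbb{C}$ (with $g=0$ on $K$). For $0<\tau\le1$, a sequence $x_0,\ldots,x_{n-1}\in K$ is $\tau$-quasi Leja if for every $k=1,\ldots,n-1$, $\prod_{j<k}|x_k-x_j|\ge\tau\max_{x\in K}\prod_{j<k}|x-x_j|$. $C(K)$ is the space of continuous functions $f:K\to\mathbb{C}$ with the uniform norm. The Lagrange interpolation operator $T_n:C(K)\to C(K)$ is $T_nf(x)=\sum_{k=0}^{n-1}f(x_k)L_{k,n}(x)$, where $L_{k,n}(x)=\prod_{0\le j\le n-1,\,j\ne k}\frac{x-x_j}{x_k-x_j}$, and $\Lambda_n=\|T_n\|$ is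 its operator norm (the $n$-th Lebesgue constant). *)

theory Defs
  imports "HOL-Complex_Analysis.Complex_Analysis"
begin

definition harmonic_on :: "complex set \<Rightarrow> (complex \<Rightarrow> real) \<Rightarrow> bool" where
  "harmonic_on S u \<longleftrightarrow> open S \<and>
     (\<forall>z\<in>S. \<exists>r>0. ball z r \<subseteq> S \<and>
        (\<exists>f. f holomorphic_on ball z r \<and> (\<forall>w\<in>ball z r. u w = Re (f w))))"

text \<open>g is the Green function of the complement of K (complement connected is
not needed in our application K \<subseteq> R) with pole at infinity, and it is continuous
on C with g = 0 on K (i.e. K is regular).\<close>
definition regular_green :: "complex set \<Rightarrow> (complex \<Rightarrow> real) \<Rightarrow> bool" where
  "regular_green K g \<longleftrightarrow>
     continuous_on UNIV g \<and> (\<forall>z\<in>K. g z = 0) \<and> harmonic_on (- K) g \<and>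
     (\<exists>C. \<forall>\<^sub>F z in at_infinity. \<bar>g z - ln (cmod z)\<bar> \<le> C)"

definition quasi_leja :: "complex set \<Rightarrow> real \<Rightarrow> (nat \<Rightarrow> complex) \<Rightarrow> nat \<Rightarrow> bool" where
  "quasi_leja K \<tau> x n \<longleftrightarrow> (\<forall>k<n. x k \<in> K) \<and>
     (\<forall>k. 1 \<le> k \<and> k \<le> n - 1 \<longrightarrow>
        (\<Prod>j<k. cmod (x k - x j)) \<ge> \<tau> * (SUP y\<in>K. \<Prod>j<k. cmod (y - x j)))"

definition lagrange_basis :: "(nat \<Rightarrow> complex) \<Rightarrow> nat \<Rightarrow> nat \<Rightarrow> complex \<Rightarrow> complex" where
  "lagrange_basis x n k y = (\<Prod>j\<in>{0..<n} - {k}. (y - x j) / (x k - x j))"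

definition lagrange_interp :: "(nat \<Rightarrow> complex) \<Rightarrow> nat \<Rightarrow> (complex \<Rightarrow> complex) \<Rightarrow> complex \<Rightarrow> complex" where
  "lagrange_interp x n f y = (\<Sum>k<n. f (x k) * lagrange_basis x n k y)"

definition lebesgue_const :: "complex set \<Rightarrow> (nat \<Rightarrow> complex) \<Rightarrow> nat \<Rightarrow> real" where
  "lebesgue_const K x n =
     (SUP f\<in>{f. continuous_on K f \<and> (\<forall>y\<in>K. cmod (f y) \<le> 1)}.
        SUP y\<in>K. cmod (lagrange_interp x n f y))"

end

(*
Write T = 1/tau. If x_k is translated to 0, the basis polynomial L_k at z is the product of
|1 - z/x_j| over j <> k. The nodes with j < k contribute at most T. For the later nodes one bounds,
by induction along the sequence, the weighted mean F(-a)^(b/(a+b)) F(b)^(a/(a+b)) of the partial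
products at two points -a < 0 < b of K. A new node outside (-a,b), or c in (0,b) with
b <= c exp lam, does not increase it. For any other node c in (0,b) the quasi Leja inequality at c
allows one to replace the pair (-a,b) by (-a,c); this costs T * ((a+b)/(a+c))^(9/8), and T is paid
for by the decrease of ln b by lam. A value at a single point is compared in the same way with the
pair formed by it and the first node on the other side of 0, at the cost of a factor 2T.

The scales range over [rho, diam K] since the nodes are separated by rho = tau delta exp(-n G):
the Bernstein-Walsh inequality and the maximum principle on the disc of radius delta about x_i bound
P_m/(z - x_i) at z = x_m, where P_m is the monic polynomial with zeros x_0, ..., x_(m-1), while
|P_m(x_m)| >= tau max_K |P_m|.
*)
theory Submission
  imports Defs
begin

section \<open>Scalar inequalities\<close>

text \<open>Gibbs' variational principle: right side minus left side is the relative entropy of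
  \<open>(x, 1 - x)\<close> with respect to \<open>(w, 1 - w)\<close>, where \<open>w\<close> is the
  maximiser; it is nonnegative because \<open>ln u \<le> u - 1\<close>.\<close>

lemma entropy_gibbs:
  fixes x A :: real
  assumes "0 < x" "x < 1"
  shows "- x * ln x - (1 - x) * ln (1 - x) + x * A \<le> ln (1 + exp A)"
proof -
  define w where "w = exp A / (1 + exp A)"
  have pos: "1 + exp A > 0" by (simp add: add_pos_pos)
  have w: "0 < w" "1 - w = 1 / (1 + exp A)"
    using pos by (auto simp: w_def field_simps)
  have w1: "0 < 1 - w" using pos w(2) by simp
  have "x * ln (w / x) \<le> x * (w / x - 1)"
    using assms w by (intro mult_left_mono ln_le_minus_one) auto
  moreover have "(1 - x) * ln ((1 - w) / (1 - x)) \<le> (1 - x) * ((1 - w) / (1 - x) - 1)"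
    using assms w1 by (intro mult_left_mono ln_le_minus_one) auto
  moreover have "x * (w / x - 1) = w - x" "(1 - x) * ((1 - w) / (1 - x) - 1) = x - w"
    using assms by (simp_all add: field_simps)
  ultimately have "x * ln (w / x) + (1 - x) * ln ((1 - w) / (1 - x)) \<le> 0"
    by simp
  moreover have "ln (w / x) = A - ln (1 + exp A) - ln x"
    using assms w(1) pos by (simp add: ln_div ln_mult w_def)
  moreover have "ln ((1 - w) / (1 - x)) = - ln (1 + exp A) - ln (1 - x)"
    using assms pos unfolding w(2) by (simp add: ln_div ln_mult)
  ultimately show ?thesis by (simp add: algebra_simps)
qed

section \<open>Elementary estimates of powers and logarithms\<close>

lemma powr_le_tangent:
  fixes v r :: real
  assumes "0 < v" "0 \<le> r" "r \<le> 1"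
  shows "v powr r \<le> 1 - r + r * v"
  using Youngs_inequality_0[of r "1 - r" v 1] assms by simp

lemma ln_one_minus_le_quadratic:
  fixes e :: real
  assumes "0 \<le> e" "e < 1"
  shows "ln (1 - e) \<le> - e - e\<^sup>2 / 2"
proof -
  define f where "f = (\<lambda>e::real. - e - e\<^sup>2 / 2 - ln (1 - e))"
  have "f 0 \<le> f e"
  proof (rule DERIV_nonneg_imp_nondecreasing[OF assms(1)])
    fix t :: real assume t: "0 \<le> t" "t \<le> e"
    have "(f has_real_derivative (- 1 - t + 1 / (1 - t))) (at t)"
      unfolding f_def using t assms by (auto intro!: derivative_eq_intros)
    moreover have "- 1 - t + 1 / (1 - t) = t\<^sup>2 / (1 - t)"
      using t assms by (simp add: field_simps power2_eq_square)
    ultimately show "\<exists>y. (f has_real_derivative y) (at t) \<and> 0 \<le> y"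
      using t assms by (intro exI[of _ "t\<^sup>2 / (1 - t)"]) auto
  qed
  then show ?thesis by (simp add: f_def)
qed

text \<open>The maximum of \<open>ln z / z\<close> is \<open>exp (-1)\<close>, and the quadratic
  Taylor polynomial gives \<open>exp 1 \<ge> 5/2\<close>.\<close>

lemma ln_le_two_fifths:
  fixes z :: real
  assumes "0 < z"
  shows "ln z \<le> 2/5 * z"
proof -
  have "5/2 \<le> exp (1::real)"
    using exp_lower_Taylor_quadratic[of 1] by simp
  then have "inverse (exp 1) \<le> (2/5 :: real)"
    using le_imp_inverse_le[of "5/2" "exp 1 :: real"] by simp
  have "ln (z * inverse (exp 1)) \<le> z * inverse (exp 1) - 1"
    using assms by (intro ln_le_minus_one) auto
  moreover have "ln (z * inverse (exp 1)) = ln z - 1"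
    using assms by (simp add: ln_mult ln_inverse)
  ultimately have "ln z \<le> z * inverse (exp 1)" by simp
  also have "\<dots> \<le> z * (2/5)"
    using assms \<open>inverse (exp 1) \<le> 2/5\<close> by (intro mult_left_mono) auto
  finally show ?thesis by simp
qed

lemma ln_le_tangent:
  fixes z w :: real
  assumes "0 < z" "0 < w"
  shows "ln z \<le> ln w + z / w - 1"
  using ln_le_minus_one[of "z / w"] assms by (simp add: ln_div)

text \<open>Shaped for \<open>ln_one_plus_le_mixed\<close> with \<open>z = v + 1/2\<close>. The
  tangents at 2, 4 and 16 serve on three intervals; powers of 2 are used so that only a bound for
  \<open>ln 2\<close> enters. The slope 9/40 is what is left of 9/8 in
  \<open>entropy_drop_ge1\<close> after 1/2 and 2/5 are spent.\<close>

lemma ln_le_rational: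
  fixes z :: real
  assumes "3/2 \<le> z"
  shows "ln z \<le> 9/40 * z + 71/80 - 1 / z"
proof -
  have z: "0 < z" using assms by simp
  have ln4: "ln (4::real) = 2 * ln 2" and ln16: "ln (16::real) = 4 * ln 2"
    using ln_realpow[of "2::real" 2] ln_realpow[of "2::real" 4] by auto
  consider "z \<le> 3" | "3 \<le> z" "z \<le> 8" | "8 \<le> z" by linarith
  then show ?thesis
  proof cases
    case 1
    have "(z - 3/2) * (3 - z) \<ge> 0" using 1 assms by (intro mult_nonneg_nonneg) auto
    then have "z / 2 - 11/36 \<le> 9/40 * z + 71/80 - 1 / z"
      using z 1 assms by (simp add: field_simps power2_eq_square)
    then show ?thesis
      using ln_le_tangent[OF z, of 2] ln2_le_25_over_36 by simp
  next
    case 2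
    have "(z - 3) * (8 - z) \<ge> 0" using 2 by (intro mult_nonneg_nonneg) auto
    then have "z / 4 + 14/36 \<le> 9/40 * z + 71/80 - 1 / z"
      using z 2 by (simp add: field_simps power2_eq_square)
    then show ?thesis
      using ln_le_tangent[OF z, of 4] ln2_le_25_over_36 ln4 by simp
  next
    case 3
    have "1 / z \<le> 1 / 8" using 3 by (intro divide_left_mono) auto
    then have "z / 16 + 64/36 \<le> 9/40 * z + 71/80 - 1 / z"
      using 3 by linarith
    then show ?thesis
      using ln_le_tangent[OF z, of 16] ln2_le_25_over_36 ln16 by simp
  qed
qed

text \<open>The left side is the [1/1] Pade approximant \<open>2 * g / (2 + g)\<close> of
  \<open>ln (1 + g)\<close> at \<open>g = 1 / v\<close>; the difference vanishes at 0 and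
  increases.\<close>

lemma ln_ge_Pade:
  fixes v :: real
  assumes "0 < v"
  shows "2 / (2 * v + 1) \<le> ln (1 + 1 / v)"
proof -
  define f where "f = (\<lambda>g::real. ln (1 + g) - 2 * g / (2 + g))"
  have "f 0 \<le> f (1 / v)"
  proof (rule DERIV_nonneg_imp_nondecreasing[of 0 "1 / v" f])
    show "0 \<le> 1 / v" using assms by simp
  next
    fix g :: real assume g: "0 \<le> g" "g \<le> 1 / v"
    have "(f has_real_derivative (1 / (1 + g) - 4 / (2 + g)\<^sup>2)) (at g)"
      unfolding f_def using g
      by (auto intro!: derivative_eq_intros simp: field_simps power2_eq_square)
    moreover have "1 / (1 + g) - 4 / (2 + g)\<^sup>2 = g\<^sup>2 / ((1 + g) * (2 + g)\<^sup>2)"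
      using g by (simp add: divide_simps power2_eq_square) (auto simp: algebra_simps)
    ultimately show "\<exists>y. (f has_real_derivative y) (at g) \<and> 0 \<le> y"
      using g by (intro exI[of _ "g\<^sup>2 / ((1 + g) * (2 + g)\<^sup>2)"]) auto
  qed
  moreover have "2 * (1 / v) / (2 + 1 / v) = 2 / (2 * v + 1)"
    using assms by (simp add: divide_simps)
  ultimately show ?thesis by (simp add: f_def)
qed

text \<open>For \<open>v \<le> 1\<close> the quotient \<open>ln (1 + s) / s\<close> is at most
  \<open>ln 2\<close>, its value at \<open>s = 1\<close>. For larger \<open>v\<close> the tangent of
  \<open>ln\<close> at \<open>v + 1/2\<close> is used: \<open>s\<close> times its slope is exactly
  \<open>s\<close> times the Pade bound.\<close>

lemma ln_one_plus_le_mixed: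
  fixes s v :: real
  assumes s: "1 \<le> s" and v: "0 < v"
  shows "ln (1 + s) \<le> s * ln (1 + 1 / v) + 9/40 * v"
proof (cases "v \<le> 1")
  case True
  have "ln ((1 + s) powr (1 / s)) \<le> ln 2"
    using powr_le_tangent[of "1 + s" "1 / s"] s by (intro ln_mono) (auto simp: field_simps)
  then have "ln (1 + s) \<le> s * ln 2"
    using s by (simp add: ln_powr field_simps)
  also have "ln 2 \<le> ln (1 + 1 / v)"
    using True v by (intro ln_mono) (auto simp: field_simps)
  then have "s * ln 2 \<le> s * ln (1 + 1 / v)"
    using s by (intro mult_left_mono) auto
  finally show ?thesis using v by simp
next
  case False
  define z where "z = v + 1/2"
  have z: "3/2 \<le> z" using False by (simp add: z_def)
  have "ln (1 + s) \<le> ln z + (1 + s) / z - 1"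
    using s z by (intro ln_le_tangent) auto
  also have "\<dots> \<le> s / z + 9/40 * v"
    using ln_le_rational[OF z] z by (simp add: z_def add_divide_distrib)
  also have "s / z \<le> s * ln (1 + 1 / v)"
    using mult_left_mono[OF ln_ge_Pade[OF v], of s] s v by (simp add: z_def field_simps)
  finally show ?thesis by simp
qed

text \<open>The case \<open>s \<ge> 1\<close>: after clearing \<open>s + t\<close>, everything reduces to
  \<open>ln_one_plus_le_mixed\<close> with \<open>v = t - 1\<close>.\<close>

lemma entropy_drop_ge1:
  fixes s t :: real
  assumes s: "1 \<le> s" and t: "1 < t"
  shows "ln (1 + s) / (1 + s) + s * (t - 1) / ((1 + s) * (s + t)) * ln ((1 + s) / s)
      + s / (s + t) * ln ((t - 1) / t) \<le> 9/8 * ln ((s + t) / (s + 1))"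
proof -
  define v where "v = t - 1"
  have v: "0 < v" "t = 1 + v" using t by (auto simp: v_def)
  have st: "0 < s + t" "0 < 1 + s" using s t by auto
  have "ln ((1 + s) / s) \<le> (1 + s) / s - 1"
    using s by (intro ln_le_minus_one) auto
  also have "\<dots> = 1 / s" using s by (simp add: field_simps)
  finally have "ln ((1 + s) / s) \<le> 1 / s" .
  then have "s * (t - 1) / ((1 + s) * (s + t)) * ln ((1 + s) / s) \<le> s * (t - 1) / ((1 + s) * (s + t)) * (1 / s)"
    using s t by (intro mult_left_mono) auto
  also have "\<dots> = (v / (s + t)) * (1 / (1 + s))"
    using s t v st by (simp add: field_simps)
  also have "\<dots> \<le> (v / (s + t)) * (1 / 2)"
    using s t v by (intro mult_left_mono) (auto simp: field_simps)
  finally have 1: "s * (t - 1) / ((1 + s) * (s + t)) * ln ((1 + s) / s) \<le> v / (s + t) / 2"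
    by simp
  have "ln ((s + 1) / (s + t)) \<le> (s + 1) / (s + t) - 1"
    using s t by (intro ln_le_minus_one) auto
  also have "\<dots> = - v / (s + t)" using st v by (simp add: field_simps)
  finally have 2: "v / (s + t) \<le> ln ((s + t) / (s + 1))"
    using s t by (simp add: ln_div)
  have "(t - 1) / t = 1 / (1 + 1 / v)" using v by (simp add: field_simps)
  then have 3: "ln ((t - 1) / t) = - ln (1 + 1 / v)"
    using v by (simp add: ln_div add_pos_pos)
  \<comment> \<open>Since \<open>s + t = (1 + s) + v\<close>, the new denominator leaves
    \<open>l\<close> itself, which goes to the mixed bound, plus a multiple of \<open>v\<close>
    controlled by 2/5.\<close>
  have "l / (1 + s) = (l + v * (l / (1 + s))) / (s + t)" for l
  proof -
    have "l + v * (l / (1 + s)) = (s + t) * (l / (1 + s))"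
      using st v by (simp add: field_simps)
    then show ?thesis using st by simp
  qed
  then have "ln (1 + s) / (1 + s) = (ln (1 + s) + v * (ln (1 + s) / (1 + s))) / (s + t)" .
  also have "\<dots> \<le> (s * ln (1 + 1 / v) + 9/40 * v + v * (2/5)) / (s + t)"
  proof (intro divide_right_mono add_mono mult_left_mono ln_one_plus_le_mixed)
    show "ln (1 + s) / (1 + s) \<le> 2/5"
      using ln_le_two_fifths[of "1 + s"] st by (simp add: field_simps)
  qed (use s v st in auto)
  also have "\<dots> = s / (s + t) * ln (1 + 1 / v) + 5/8 * (v / (s + t))"
    by (simp add: add_divide_distrib algebra_simps)
  finally have 4: "ln (1 + s) / (1 + s) \<le> s / (s + t) * ln (1 + 1 / v) + 5/8 * (v / (s + t))" .
  \<comment> \<open>With \<open>w = v / (s + t)\<close> the terms in \<open>ln (1 + 1 / v)\<close>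
    cancel and the constants add up to 1/2 + 5/8 = 9/8.\<close>
  have "l + A + m * - q \<le> 9/8 * L"
    if "A \<le> w / 2" "w \<le> L" "l \<le> m * q + 5/8 * w" for A w L l m q :: real
    using that by simp
  from this[OF 1 2 4] show ?thesis unfolding 3 .
qed

text \<open>The case \<open>s \<le> 1\<close> in the variables \<open>x = s / (1 + s)\<close>, \<open>r = (s + 1) / (s + t)\<close>; the
  first two terms on the left are the entropy of \<open>x\<close>.\<close>

lemma entropy_drop_small:
  fixes x r :: real
  assumes x: "0 < x" "x \<le> 1/2" and r: "0 < r" "r < 1"
  shows "- x * ln x - (1 - x) * ln (1 - x) + x * r * ln (x * (1 - r) / (1 - x * r)) \<le> 9/8 * ln (1 / r)"
proof (cases "r \<le> 2/3")
  case True
  \<comment> \<open>\<open>w\<close> increases with \<open>x\<close> and equals \<open>v\<close> at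
    \<open>x = 1/2\<close>. Once \<open>w\<close> is replaced by \<open>v\<close>, the Gibbs
    inequality eliminates \<open>x\<close>; what remains is
    \<open>(2 - 3 * r) * (1 - r) \<ge> 0\<close>, hence the threshold 2/3.\<close>
  define w v where "w = x * (1 - r) / (1 - x * r)" and "v = (1 - r) / (2 - r)"
  have xr: "x * r \<le> 1/2 * r" using x r by (intro mult_right_mono) auto
  have "0 < 1 - x * r" using xr r by linarith
  then have w: "0 < w" using x r unfolding w_def by (intro divide_pos_pos mult_pos_pos) auto
  have v: "0 < v" using r by (simp add: v_def)
  have "x * (1 - r) * (2 - r) \<le> (1 - r) * (1 - x * r)"
  proof -
    have "(1 - r) * (1 - 2 * x) \<ge> 0" using x r by simp
    then show ?thesis by (simp add: algebra_simps)
  qed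
  then have "w \<le> v"
    using r \<open>0 < 1 - x * r\<close> by (simp add: w_def v_def pos_divide_le_eq pos_le_divide_eq)
  then have "x * r * ln w \<le> x * (r * ln v)"
    unfolding mult.assoc using w x r by (intro mult_left_mono ln_mono) auto
  then have "- x * ln x - (1 - x) * ln (1 - x) + x * r * ln w \<le> ln (1 + exp (r * ln v))"
    using entropy_gibbs[of x "r * ln v"] x by linarith
  also have "exp (r * ln v) = v powr r" using v by (simp add: powr_def)
  also have "ln (1 + v powr r) \<le> ln (1 / r)"
  proof (rule ln_mono)
    have "1 + v powr r \<le> 1 + (1 - r + r * v)"
      using powr_le_tangent[OF v, of r] r by simp
    also have "\<dots> = (4 - 3 * r) / (2 - r)"
      using r by (simp add: v_def field_simps power2_eq_square)
    also have "\<dots> \<le> 1 / r"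
    proof -
      have "(2 - 3 * r) * (1 - r) \<ge> 0" using True r by (intro mult_nonneg_nonneg) auto
      then show ?thesis using r by (simp add: field_simps power2_eq_square)
    qed
    finally show "1 + v powr r \<le> 1 / r" .
  qed (use v in \<open>auto intro: add_pos_pos\<close>)
  also have "\<dots> \<le> 9/8 * ln (1 / r)"
    using r by (simp add: ln_div)
  finally show ?thesis by (simp add: w_def)
next
  case False
  define e where "e = 1 - r"
  have e: "0 < e" "e < 1/3" "r = 1 - e" using False r by (auto simp: e_def)
  have xr: "x * r \<le> 1/2 * r" using x r by (intro mult_right_mono) auto
  \<comment> \<open>\<open>z\<close> is the value of \<open>e / (1 - x * r)\<close> at
    \<open>x = 1/2\<close>, an upper bound. The tangent of \<open>ln\<close> at 1/2 then leaves the
    bound \<open>2/5 * e + x * k\<close>, affine in \<open>x\<close>.\<close>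
  define z where "z = 2 * e / (1 + e)"
  define k where "k = 1 + (1 - e) * (2 * z - 5/3)"
  have z: "0 < z" using e by (simp add: z_def)
  have "(1 + e) / 2 = 1 - 1/2 * r" by (simp add: e(3) field_simps)
  then have xr': "(1 + e) / 2 \<le> 1 - x * r" using xr by linarith
  then have xr_pos: "0 < 1 - x * r"
    by (rule less_le_trans[rotated]) (use e(1) in simp)
  have "e / (1 - x * r) \<le> e / ((1 + e) / 2)"
    using xr' xr_pos e by (intro divide_left_mono) auto
  then have "ln (e / (1 - x * r)) \<le> ln z"
    using xr_pos e by (intro ln_mono) (auto simp: z_def mult.commute)
  also have "\<dots> \<le> 2 * z - 5/3"
    using ln_le_tangent[OF z, of "1/2"] ln2_ge_two_thirds by (simp add: ln_div)
  finally have 1: "x * r * ln (e / (1 - x * r)) \<le> x * r * (2 * z - 5/3)"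
    using x r by (intro mult_left_mono) auto
  have "ln (1 / x) \<le> 2/5 * (1 / x)"
    using x by (intro ln_le_two_fifths) auto
  then have "x * e * ln (1 / x) \<le> x * e * (2/5 * (1 / x))"
    using x e by (intro mult_left_mono) auto
  then have 2: "- x * e * ln x \<le> 2/5 * e"
    using x by (simp add: ln_div)
  have "(1 - x) * ln (1 / (1 - x)) \<le> (1 - x) * (1 / (1 - x) - 1)"
    using x by (intro mult_left_mono ln_le_minus_one) auto
  then have 3: "- (1 - x) * ln (1 - x) \<le> x"
    using x by (simp add: ln_div algebra_simps)
  have "ln (x * (1 - r) / (1 - x * r)) = ln x + ln (e / (1 - x * r))"
    using x e xr_pos by (simp add: ln_mult ln_div)
  then have "- x * ln x - (1 - x) * ln (1 - x) + x * r * ln (x * (1 - r) / (1 - x * r))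
      = - x * e * ln x - (1 - x) * ln (1 - x) + x * r * ln (e / (1 - x * r))"
    by (simp add: e(3) algebra_simps)
  also have "\<dots> \<le> 2/5 * e + x * k"
    using 1 2 3 by (simp add: k_def e(3) algebra_simps)
  also have "\<dots> \<le> 9/8 * (e + e\<^sup>2 / 2)"
  proof (cases "k \<le> 0")
    case True
    then have "x * k \<le> 0" using x by (simp add: mult_nonneg_nonpos)
    moreover have "0 \<le> e\<^sup>2 / 2" by simp
    ultimately show ?thesis using e(1) by argo
  next
    case False
    have xk: "x * k \<le> 1/2 * k" using x False by (intro mult_right_mono) auto
    have k_eq: "5 * e - 2/3 - 7/3 * e\<^sup>2 = (1 + e) * k"
      using e by (simp add: k_def z_def field_simps power2_eq_square)
    \<comment> \<open>The cubic below is \<open>1 + e\<close> times the gap between the two sides at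
      \<open>x = 1/2\<close>; 9/25 is close to the minimiser of its quadratic part.\<close>
    have "0 \<le> (7/6 + 103/80) * (e - 9/25)\<^sup>2 + 9/16 * e ^ 3" using e by simp
    also have "\<dots> \<le> 1/3 - 71/40 * e + (7/6 + 103/80) * e\<^sup>2 + 9/16 * e ^ 3"
      using e by (simp add: power2_eq_square algebra_simps)
    also have "\<dots> = (1 + e) * (9/8 * (e + e\<^sup>2 / 2)) - ((1 + e) * (2/5 * e) + 1/2 * (5 * e - 2/3 - 7/3 * e\<^sup>2))"
      by (simp add: field_simps power2_eq_square power3_eq_cube)
    finally have "(1 + e) * (2/5 * e) + 1/2 * ((1 + e) * k) \<le> (1 + e) * (9/8 * (e + e\<^sup>2 / 2))"
      unfolding k_eq diff_ge_0_iff_ge .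
    then have "(1 + e) * (2/5 * e + 1/2 * k) \<le> (1 + e) * (9/8 * (e + e\<^sup>2 / 2))"
      unfolding distrib_left[of "1 + e" "2/5 * e"] by simp
    then have "2/5 * e + 1/2 * k \<le> 9/8 * (e + e\<^sup>2 / 2)"
      using e by simp
    then show ?thesis using xk by linarith
  qed
  also have "\<dots> \<le> 9/8 * ln (1 / r)"
    using ln_one_minus_le_quadratic[of e] e by (simp add: ln_div)
  finally show ?thesis .
qed

text \<open>The logarithm of the loss when the pair of nodes \<open>-a, b\<close> is replaced by \<open>-a, c\<close>, where
  \<open>s = a / c\<close>, \<open>t = b / c\<close>, so that the argument of the last logarithm is \<open>(a + b) / (a + c)\<close>.\<close>

lemma entropy_drop:
  fixes s t :: real
  assumes s: "0 < s" and t: "1 < t"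
  shows "ln (1 + s) / (1 + s) + s * (t - 1) / ((1 + s) * (s + t)) * ln ((1 + s) / s)
      + s / (s + t) * ln ((t - 1) / t) \<le> 9/8 * ln ((s + t) / (s + 1))"
proof (cases "1 \<le> s")
  case True
  then show ?thesis using entropy_drop_ge1 t by simp
next
  case False
  define x r where "x = s / (1 + s)" and "r = (s + 1) / (s + t)"
  have pos: "0 < s + t" "0 < 1 + s" "0 < t - 1" "0 < t" using s t by auto
  have x: "0 < x" "x \<le> 1/2" using s False by (auto simp: x_def field_simps)
  have r: "0 < r" "r < 1" using pos by (auto simp: r_def field_simps)
  have xr: "x * r = s / (s + t)" using pos by (simp add: x_def r_def add.commute)
  have x1: "1 - x = 1 / (1 + s)" using pos by (simp add: x_def field_simps)
  have r1: "1 - r = (t - 1) / (s + t)" using pos by (simp add: r_def field_simps)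
  have xr1: "x - x * r = s * (t - 1) / ((1 + s) * (s + t))"
    using pos unfolding xr by (simp add: x_def field_simps)
  have "1 - x * r = t / (s + t)" using pos unfolding xr by (simp add: field_simps)
  then have "x * (1 - r) / (1 - x * r) = x * ((t - 1) / t)"
    using pos unfolding r1 by (simp add: field_simps)
  then have "ln (x * (1 - r) / (1 - x * r)) = ln x + ln ((t - 1) / t)"
    using x pos by (simp add: ln_mult ln_div)
  then have "- x * ln x - (1 - x) * ln (1 - x) + x * r * ln (x * (1 - r) / (1 - x * r))
      = - (1 - x) * ln (1 - x) + (x - x * r) * (- ln x) + x * r * ln ((t - 1) / t)"
    by (simp add: algebra_simps)
  also have "- ln x = ln ((1 + s) / s)" using s pos by (simp add: x_def ln_div)
  also have "- (1 - x) * ln (1 - x) = ln (1 + s) / (1 + s)"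
    using pos unfolding x1 by (simp add: ln_div)
  finally have "ln (1 + s) / (1 + s) + (x - x * r) * ln ((1 + s) / s) + x * r * ln ((t - 1) / t)
     \<le> 9/8 * ln (1 / r)"
    using entropy_drop_small[OF x r] by simp
  then show ?thesis unfolding xr1 unfolding xr by (simp add: r_def)
qed

section \<open>Products over quasi Leja points\<close>

text \<open>With the weights \<open>b / (a + b)\<close> and \<open>a / (a + b)\<close> the points \<open>-a\<close> and \<open>b\<close> have barycentre \<open>0\<close>.
  A node \<open>c \<ge> b\<close> is harmless by concavity of the logarithm; for \<open>c < b \<le> c exp lam\<close> the equation
  for \<open>lam\<close> says precisely that the gain at \<open>b\<close> outweighs the loss at \<open>-a\<close>.\<close>

lemma balanced_factor_le_1:
  fixes a b c lam :: real
  assumes pos: "0 < a" "0 < b" "0 < c" and lam: "exp (exp lam) * (exp lam - 1) = 1"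
    and bc: "b \<le> c * exp lam"
  shows "(1 + a / c) powr (b / (a + b)) * \<bar>1 - b / c\<bar> powr (a / (a + b)) \<le> 1"
proof -
  consider "b < c" | "b = c" | "c < b" by linarith
  then show ?thesis
  proof cases
    case 1
    have "(1 + a / c) powr (b / (a + b)) * (1 - b / c) powr (a / (a + b))
        \<le> b / (a + b) * (1 + a / c) + a / (a + b) * (1 - b / c)"
      using pos 1 by (intro Youngs_inequality_0) (auto simp: add_pos_pos add.commute simp flip: add_divide_distrib)
    also have "\<dots> = b / (a + b) + a / (a + b)"
      by (simp add: algebra_simps flip: add_divide_distrib)
    also have "\<dots> = 1" using pos by (simp add: add.commute flip: add_divide_distrib)
    finally show ?thesis using 1 pos by (simp add: field_simps)
  next
    case 2
    then show ?thesis using pos by simp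
  next
    case 3
    have t: "b / c \<le> exp lam" "1 < b / c" using pos bc 3 by (auto simp: field_simps)
    \<comment> \<open>\<open>exp u * (u - 1)\<close> increases for \<open>u \<ge> 1\<close>. This
      turns the factor at \<open>b\<close> into \<open>exp (- (b / c))\<close>; against
      \<open>exp (a / c)\<close> at \<open>-a\<close> the weighted exponents cancel exactly.\<close>
    have "exp (b / c) * (b / c - 1) \<le> exp (exp lam) * (exp lam - 1)"
      using t by (intro mult_mono) auto
    then have "b / c - 1 \<le> exp (- (b / c))"
      unfolding lam by (simp add: exp_minus field_simps)
    moreover have "1 + a / c \<le> exp (a / c)" by (rule exp_ge_add_one_self)
    ultimately have "(1 + a / c) powr (b / (a + b)) * \<bar>1 - b / c\<bar> powr (a / (a + b))
        \<le> exp (a / c) powr (b / (a + b)) * exp (- (b / c)) powr (a / (a + b))"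
      using pos t by (intro mult_mono powr_mono2) auto
    also have "\<dots> = exp (b / (a + b) * (a / c) + a / (a + b) * (- (b / c)))"
      by (simp add: exp_powr_real mult_exp_exp algebra_simps)
    also have "\<dots> = 1" by simp
    finally show ?thesis .
  qed
qed

text \<open>\<open>U\<close>, \<open>V\<close>, \<open>C\<close> stand for the partial product at
  \<open>-a\<close>, \<open>b\<close> and the node \<open>c\<close>; the last two hypotheses are the
  quasi Leja inequality at \<open>c\<close>. Only the share \<open>p\<close> of the exponent
  \<open>P\<close> stays with \<open>U\<close>; the rest \<open>P - p\<close> and all of
  \<open>Q\<close> pass to \<open>C\<close>. As \<open>P - p + Q = q \<le> 1\<close>, this costs at
  most one \<open>T\<close>, and \<open>entropy_drop\<close> bounds the remaining factor.\<close>

lemma balanced_drop: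
  fixes a b c T U C V :: real
  assumes pos: "0 < a" "0 < c" "c < b" and nonneg: "0 \<le> U" "0 \<le> C" "0 \<le> V" and T: "1 \<le> T"
    and U: "U * a \<le> T * (C * c)" and V: "V * b \<le> T * (C * c)"
  shows "(U * (1 + a / c)) powr (b / (a + b)) * (V * (b / c - 1)) powr (a / (a + b))
    \<le> T * ((a + b) / (a + c)) powr (9/8) * (U powr (c / (a + c)) * C powr (a / (a + c)))"
proof -
  define s t where "s = a / c" and "t = b / c"
  define P Q p q where "P = b / (a + b)" and "Q = a / (a + b)" and "p = c / (a + c)" and "q = a / (a + c)"
  have st: "0 < s" "1 < t" using pos by (auto simp: s_def t_def)
  have Pp: "P - p = s * (t - 1) / ((1 + s) * (s + t))"
  proof -
    have "P - p = (b * (a + c) - c * (a + b)) / ((a + b) * (a + c))"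
      using pos unfolding P_def p_def by (subst diff_frac_eq) auto
    also have "\<dots> = a * (b - c) / ((a + b) * (a + c))" by (simp add: algebra_simps)
    also have "\<dots> = (s * c) * ((t - 1) * c) / (((s + t) * c) * ((1 + s) * c))"
      using pos by (simp add: s_def t_def left_diff_distrib distrib_right add.commute)
    also have "\<dots> = s * (t - 1) / ((1 + s) * (s + t))" using pos by simp
    finally show ?thesis .
  qed
  have p: "p = 1 / (1 + s)" using pos by (simp add: p_def s_def field_simps)
  have Q: "Q = s / (s + t)" using pos by (simp add: Q_def s_def t_def field_simps)
  have le: "0 \<le> p" "0 \<le> Q" "0 \<le> q" "q \<le> 1" "0 \<le> P - p"
    using pos st unfolding Pp by (auto simp: p_def q_def Q_def)
  have "P + Q = 1" "p + q = 1"
    using pos by (auto simp: P_def Q_def p_def q_def simp flip: add_divide_distrib)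
  then have q: "q = P - p + Q" by simp
  have facs: "1 + a / c = 1 + s" "(a + c) / a = (1 + s) / s" "(b - c) / b = (t - 1) / t"
    using pos by (auto simp: s_def t_def field_simps)
  have "(a + b) / (a + c) = ((s + t) * c) / ((s + 1) * c)"
    using pos by (simp add: s_def t_def distrib_right)
  then have facs4: "(a + b) / (a + c) = (s + t) / (s + 1)" using pos by simp
  have U': "U * (1 + a / c) \<le> T * C * ((a + c) / a)"
  proof -
    have "U * (1 + a / c) = U * a * ((a + c) / (a * c))" using pos by (simp add: field_simps)
    also have "\<dots> \<le> T * (C * c) * ((a + c) / (a * c))"
      using pos U by (intro mult_right_mono) auto
    also have "\<dots> = T * C * ((a + c) / a)" using pos by simp
    finally show ?thesis .
  qed
  have V': "V * (b / c - 1) \<le> T * C * ((b - c) / b)"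
  proof -
    have "V * (b / c - 1) = V * b * ((b - c) / (b * c))" using pos by (simp add: field_simps)
    also have "\<dots> \<le> T * (C * c) * ((b - c) / (b * c))"
      using pos V by (intro mult_right_mono) auto
    also have "\<dots> = T * C * ((b - c) / b)" using pos by simp
    finally show ?thesis .
  qed
  have "(U * (1 + a / c)) powr P * (V * (b / c - 1)) powr Q
      = (U * (1 + a / c)) powr p * ((U * (1 + a / c)) powr (P - p) * (V * (b / c - 1)) powr Q)"
    by (simp flip: powr_add mult.assoc)
  also have "\<dots> \<le> (U * (1 + a / c)) powr p * ((T * C * ((a + c) / a)) powr (P - p) * (T * C * ((b - c) / b)) powr Q)"
  proof (rule mult_left_mono, rule mult_mono)
    show "(U * (1 + a / c)) powr (P - p) \<le> (T * C * ((a + c) / a)) powr (P - p)"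
      using U' pos nonneg le by (intro powr_mono2) auto
    show "(V * (b / c - 1)) powr Q \<le> (T * C * ((b - c) / b)) powr Q"
      using V' pos nonneg le by (intro powr_mono2) auto
  qed auto
  also have "\<dots> = (U powr p * C powr q) * T powr q *
      ((1 + s) powr p * (((1 + s) / s) powr (P - p) * ((t - 1) / t) powr Q))"
  proof -
    have split: "(U * (1 + s)) powr p * ((T * C * X) powr (P - p) * (T * C * Y) powr Q)
      = (U powr p * C powr q) * T powr q * ((1 + s) powr p * (X powr (P - p) * Y powr Q))"
      if "0 \<le> X" "0 \<le> Y" for X Y
      using that nonneg T st unfolding q by (simp add: powr_mult powr_add)
    show ?thesis unfolding facs by (rule split) (use st in auto)
  qed
  also have "\<dots> \<le> (U powr p * C powr q) * T * ((s + t) / (s + 1)) powr (9/8)"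
  proof (intro mult_mono mult_left_mono)
    show "T powr q \<le> T" using T le powr_mono[of q 1 T] by simp
    have "(1 + s) powr p * (((1 + s) / s) powr (P - p) * ((t - 1) / t) powr Q)
        = exp (ln (1 + s) / (1 + s) + s * (t - 1) / ((1 + s) * (s + t)) * ln ((1 + s) / s)
      + s / (s + t) * ln ((t - 1) / t))"
      using st unfolding Pp unfolding p Q by (simp add: powr_def exp_add)
    also have "\<dots> \<le> exp (9/8 * ln ((s + t) / (s + 1)))"
      using entropy_drop[OF st] by simp
    also have "\<dots> = ((s + t) / (s + 1)) powr (9/8)" using st by (simp add: powr_def)
    finally show "(1 + s) powr p * (((1 + s) / s) powr (P - p) * ((t - 1) / t) powr Q) \<le> \<dots>" .
  qed (use T in auto)
  finally show ?thesis
    unfolding facs4 P_def Q_def p_def q_def by (simp add: mult_ac)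
qed

text \<open>\<open>F m z\<close> stands for the first part of the product defining a Lagrange basis polynomial: the
  node \<open>x\<^sub>k\<close> is moved to \<open>0\<close>, \<open>F 0\<close> collects the nodes chosen before \<open>x\<^sub>k\<close>, and \<open>y m\<close> are the nodes
  chosen after it.\<close>

locale quasi_leja_ratios =
  fixes S :: "real set" and F :: "nat \<Rightarrow> real \<Rightarrow> real" and y :: "nat \<Rightarrow> real" and N :: nat
    and T \<rho> d lam :: real
  assumes F_0: "z \<in> S \<Longrightarrow> F 0 z \<le> T"
    and F_nonneg: "0 \<le> F m z"
    and F_Suc: "m < N \<Longrightarrow> F (Suc m) z = F m z * \<bar>1 - z / y m\<bar>"
    and leja: "m < N \<Longrightarrow> z \<in> S \<Longrightarrow> F m z * \<bar>z\<bar> \<le> T * (F m (y m) * \<bar>y m\<bar>)"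
    and y_in: "m < N \<Longrightarrow> y m \<in> S"
    and y_sep: "m < N \<Longrightarrow> \<rho> \<le> \<bar>y m\<bar>"
    and zero_in: "0 \<in> S"
    and diam: "u \<in> S \<Longrightarrow> v \<in> S \<Longrightarrow> \<bar>u - v\<bar> \<le> d"
    and rho: "0 < \<rho>" "\<rho> \<le> d"
    and T: "1 \<le> T"
    and lam: "0 < lam" "exp (exp lam) * (exp lam - 1) = 1"
begin

text \<open>The exponent is such that enlarging the scale by \<open>exp lam\<close> gains a factor
  \<open>T\<close>; below \<open>\<rho>\<close> the factor is cut off at 1.\<close>

definition scale_factor :: "real \<Rightarrow> real" where
  "scale_factor a = (max 1 (a / \<rho>)) powr (ln T / lam)"

lemma scale_exponent_nonneg: "0 \<le> ln T / lam"
  using T lam by simp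

lemma scale_factor_ge_1: "1 \<le> scale_factor a"
  unfolding scale_factor_def using scale_exponent_nonneg by (intro ge_one_powr_ge_zero) auto

lemma scale_factor_nonneg: "0 \<le> scale_factor a"
  by (simp add: scale_factor_def)

lemma scale_factor_mono: "a \<le> b \<Longrightarrow> scale_factor a \<le> scale_factor b"
  unfolding scale_factor_def using rho scale_exponent_nonneg
  by (intro powr_mono2 max.mono divide_right_mono) auto

lemma scale_factor_drop:
  assumes "\<rho> \<le> c" "c * exp lam \<le> b"
  shows "T * scale_factor c \<le> scale_factor b"
proof -
  have c: "0 < c" using assms rho by simp
  have "exp lam powr (ln T / lam) = T"
    using T lam by (simp add: exp_powr_real)
  moreover have "max 1 (c / \<rho>) = c / \<rho>"
    using assms rho by (simp add: max_def)
  ultimately have "T * scale_factor c = exp lam powr (ln T / lam) * (c / \<rho>) powr (ln T / lam)"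
    by (simp only: scale_factor_def)
  also have "\<dots> = (exp lam * (c / \<rho>)) powr (ln T / lam)"
    using c rho by (subst powr_mult) auto
  also have "\<dots> \<le> scale_factor b"
    unfolding scale_factor_def using rho assms c scale_exponent_nonneg
    by (intro powr_mono2) (auto simp: field_simps le_max_iff_disj)
  finally show ?thesis .
qed

section \<open>Induction along the later nodes\<close>

text \<open>Each node either leaves the weighted mean no larger or replaces the endpoint on its
  side. In a replacement the length ratios telescope under the power 9/8, and the extra
  \<open>T\<close> is absorbed by \<open>scale_factor_drop\<close>. The last assumption makes the
  base at least 1 at \<open>m = 0\<close>; it survives replacement because nodes are at least
  \<open>\<rho>\<close> away from 0.\<close>

lemma pair_bound:
  assumes "m \<le> N" "u \<in> S" "v \<in> S" "u * v < 0" "\<rho> \<le> \<bar>u\<bar> + \<bar>v\<bar>"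
  shows "F m u powr (\<bar>v\<bar> / (\<bar>u\<bar> + \<bar>v\<bar>)) * F m v powr (\<bar>u\<bar> / (\<bar>u\<bar> + \<bar>v\<bar>))
    \<le> T * ((\<bar>u\<bar> + \<bar>v\<bar>) / \<rho>) powr (9/8) * (scale_factor \<bar>u\<bar> * scale_factor \<bar>v\<bar>)"
  using assms
proof (induction m arbitrary: u v)
  case 0
  have uv: "0 < \<bar>u\<bar>" "0 < \<bar>v\<bar>" using 0 by auto
  have "F 0 u powr (\<bar>v\<bar> / (\<bar>u\<bar> + \<bar>v\<bar>)) * F 0 v powr (\<bar>u\<bar> / (\<bar>u\<bar> + \<bar>v\<bar>))
      \<le> T powr (\<bar>v\<bar> / (\<bar>u\<bar> + \<bar>v\<bar>)) * T powr (\<bar>u\<bar> / (\<bar>u\<bar> + \<bar>v\<bar>))"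
    using 0 F_0 F_nonneg T by (intro mult_mono powr_mono2) auto
  also have "\<dots> = T powr ((\<bar>v\<bar> + \<bar>u\<bar>) / (\<bar>u\<bar> + \<bar>v\<bar>))"
    by (simp flip: powr_add add: add_divide_distrib)
  also have "\<dots> = T * 1 * (1 * 1)" using uv T by (simp add: add.commute)
  also have "\<dots> \<le> T * ((\<bar>u\<bar> + \<bar>v\<bar>) / \<rho>) powr (9/8) * (scale_factor \<bar>u\<bar> * scale_factor \<bar>v\<bar>)"
    using scale_factor_ge_1 scale_factor_nonneg T 0 rho by (intro mult_mono ge_one_powr_ge_zero) auto
  finally show ?case .
next
  case (Suc m)
  have m: "m < N" "m \<le> N" using Suc.prems by auto
  \<comment> \<open>The claim is symmetric in \<open>u\<close> and \<open>v\<close>, so the node may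
    be taken on the side of \<open>v\<close>.\<close>
  have step: "F (Suc m) u powr (\<bar>v\<bar> / (\<bar>u\<bar> + \<bar>v\<bar>)) * F (Suc m) v powr (\<bar>u\<bar> / (\<bar>u\<bar> + \<bar>v\<bar>))
    \<le> T * ((\<bar>u\<bar> + \<bar>v\<bar>) / \<rho>) powr (9/8) * (scale_factor \<bar>u\<bar> * scale_factor \<bar>v\<bar>)"
    if uv: "u \<in> S" "v \<in> S" "u * v < 0" "\<rho> \<le> \<bar>u\<bar> + \<bar>v\<bar>" and same: "0 < v * y m" for u v
  proof -
    define a b c where "a = \<bar>u\<bar>" and "b = \<bar>v\<bar>" and "c = \<bar>y m\<bar>"
    have pos: "0 < a" "0 < b" "0 < c" "\<rho> \<le> c"
      using uv same y_sep[OF m(1)] by (auto simp: a_def b_def c_def)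
    have opp: "u * y m < 0" using uv same by (auto simp: mult_less_0_iff zero_less_mult_iff)
    have fu: "F (Suc m) u = F m u * (1 + a / c)"
      using F_Suc[OF m(1), of u] opp by (auto simp: a_def c_def mult_less_0_iff abs_if field_simps)
    have fv: "F (Suc m) v = F m v * \<bar>1 - b / c\<bar>"
      using F_Suc[OF m(1), of v] same by (auto simp: b_def c_def zero_less_mult_iff)
    show ?thesis
    proof (cases "b \<le> c * exp lam")
      case True
      have "F (Suc m) u powr (b / (a + b)) * F (Suc m) v powr (a / (a + b))
          = (F m u powr (b / (a + b)) * F m v powr (a / (a + b))) *
            ((1 + a / c) powr (b / (a + b)) * \<bar>1 - b / c\<bar> powr (a / (a + b)))"
        unfolding fu fv using pos F_nonneg by (simp add: powr_mult)
      also have "\<dots> \<le> (F m u powr (b / (a + b)) * F m v powr (a / (a + b))) * 1"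
        using balanced_factor_le_1[OF pos(1-3) lam(2) True] by (intro mult_left_mono) auto
      also have "\<dots> \<le> T * ((a + b) / \<rho>) powr (9/8) * (scale_factor a * scale_factor b)"
        using Suc.IH[OF m(2) uv] by (simp add: a_def b_def)
      finally show ?thesis by (simp add: a_def b_def)
    next
      case False
      then have cb: "c * exp lam < b" by simp
      have "c * 1 \<le> c * exp lam" using pos lam by (intro mult_left_mono) auto
      with cb have "c < b" by simp
      then have absb: "\<bar>1 - b / c\<bar> = b / c - 1" using pos by (simp add: field_simps)
      have IH: "F m u powr (c / (a + c)) * F m (y m) powr (a / (a + c))
          \<le> T * ((a + c) / \<rho>) powr (9/8) * (scale_factor a * scale_factor c)"
        using Suc.IH[OF m(2) uv(1) y_in[OF m(1)] opp] pos(1,4) by (simp add: a_def c_def)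
      have "F (Suc m) u powr (b / (a + b)) * F (Suc m) v powr (a / (a + b))
          \<le> T * ((a + b) / (a + c)) powr (9/8) * (F m u powr (c / (a + c)) * F m (y m) powr (a / (a + c)))"
        unfolding fu fv absb
        using leja[OF m(1) uv(1)] leja[OF m(1) uv(2)] F_nonneg T pos \<open>c < b\<close>
        by (intro balanced_drop) (auto simp: a_def b_def c_def)
      also have "\<dots> \<le> T * ((a + b) / (a + c)) powr (9/8) *
          (T * ((a + c) / \<rho>) powr (9/8) * (scale_factor a * scale_factor c))"
        using IH T by (intro mult_left_mono) auto
      also have "\<dots> = T * (((a + b) / (a + c)) * ((a + c) / \<rho>)) powr (9/8) *
          (scale_factor a * (T * scale_factor c))"
        using pos rho by (subst powr_mult) auto
      also have "((a + b) / (a + c)) * ((a + c) / \<rho>) = (a + b) / \<rho>" using pos by simp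
      also have "T * ((a + b) / \<rho>) powr (9/8) * (scale_factor a * (T * scale_factor c))
          \<le> T * ((a + b) / \<rho>) powr (9/8) * (scale_factor a * scale_factor b)"
        using scale_factor_drop[OF pos(4), of b] cb T scale_factor_ge_1[of a]
        by (intro mult_left_mono) auto
      finally show ?thesis by (simp add: a_def b_def)
    qed
  qed
  have "y m \<noteq> 0" using y_sep[OF m(1)] rho by auto
  then consider "0 < v * y m" | "0 < u * y m"
    using Suc.prems by (auto simp: mult_less_0_iff zero_less_mult_iff neq_iff)
  then show ?case
  proof cases
    case 1
    then show ?thesis using step Suc.prems by blast
  next
    case 2
    then show ?thesis using step[of v u] Suc.prems by (simp add: mult_ac add_ac)
  qed
qed

text \<open>Ensures in \<open>single_bound\<close> that a node on the side of the point with
  \<open>b \<le> c * exp lam\<close> contributes a factor at most 1.\<close>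

lemma exp_lam_le_2: "exp lam \<le> 2"
proof (rule ccontr)
  assume "\<not> exp lam \<le> 2"
  then have "1 * 1 < exp (exp lam) * (exp lam - 1)"
    by (intro mult_strict_mono) auto
  then show False using lam by simp
qed

text \<open>A node on the side of \<open>z\<close> is harmless or takes the place of
  \<open>z\<close>, the cost \<open>T\<close> being paid by the scale factor. A node on the other
  side ends the recursion: the value at \<open>z\<close> is then compared with
  \<open>pair_bound\<close> for \<open>z\<close> and that node.\<close>

lemma single_bound:
  assumes "m \<le> N" "z \<in> S"
  shows "F m z \<le> 2 * T\<^sup>2 * (d / \<rho>) powr (9/8) * (scale_factor \<bar>z\<bar> * scale_factor d)"
  using assms
proof (induction m arbitrary: z)
  case 0
  have "F 0 z \<le> T" using 0 F_0 by simp
  also have "\<dots> \<le> 2 * T\<^sup>2 * 1 * (1 * 1)" using T by (simp add: power2_eq_square)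
  also have "\<dots> \<le> 2 * T\<^sup>2 * (d / \<rho>) powr (9/8) * (scale_factor \<bar>z\<bar> * scale_factor d)"
    using scale_factor_ge_1 scale_factor_nonneg T rho by (intro mult_mono ge_one_powr_ge_zero) auto
  finally show ?case .
next
  case (Suc m)
  have m: "m < N" "m \<le> N" using Suc.prems by auto
  define b c where "b = \<bar>z\<bar>" and "c = \<bar>y m\<bar>"
  define R where "R = 2 * T\<^sup>2 * (d / \<rho>) powr (9/8)"
  have R: "0 \<le> R" by (simp add: R_def)
  have c: "0 < c" "\<rho> \<le> c" using y_sep[OF m(1)] rho by (auto simp: c_def)
  have cd: "c \<le> d" using diam[OF y_in[OF m(1)] zero_in] by (simp add: c_def)
  have lz: "F m z * b \<le> T * (F m (y m) * c)"
    using leja[OF m(1) Suc.prems(2)] by (simp add: b_def c_def)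
  show ?case
  proof (cases "0 \<le> z * y m")
    case True
    then have fz: "F (Suc m) z = F m z * \<bar>1 - b / c\<bar>"
      using F_Suc[OF m(1), of z] c by (auto simp: b_def c_def zero_le_mult_iff)
    show ?thesis
    proof (cases "b \<le> c * exp lam")
      case True
      have "b \<le> c * 2" using True exp_lam_le_2 c by (meson mult_left_mono order.trans less_imp_le)
      then have "\<bar>1 - b / c\<bar> \<le> 1" using c by (auto simp: b_def abs_le_iff field_simps)
      then have "F (Suc m) z \<le> F m z * 1"
        unfolding fz using F_nonneg by (intro mult_left_mono) auto
      then show ?thesis using Suc.IH[OF m(2) Suc.prems(2)] by simp
    next
      case False
      have "c * 1 \<le> c * exp lam" using c lam by (intro mult_left_mono) auto
      with False have cb: "c < b" "c * exp lam \<le> b" by auto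
      then have "F (Suc m) z = F m z * b * ((b - c) / (b * c))"
        unfolding fz using c by (simp add: field_simps)
      also have "\<dots> \<le> T * (F m (y m) * c) * ((b - c) / (b * c))"
        using lz c cb by (intro mult_right_mono) auto
      also have "\<dots> = T * F m (y m) * ((b - c) / b)" using c by simp
      also have "\<dots> \<le> T * F m (y m) * 1"
        using T F_nonneg c cb by (intro mult_left_mono) auto
      also have "\<dots> \<le> T * (R * (scale_factor c * scale_factor d))"
        using Suc.IH[OF m(2) y_in[OF m(1)]] T unfolding R_def c_def by (simp add: mult_left_mono)
      also have "\<dots> = R * ((T * scale_factor c) * scale_factor d)" by simp
      also have "\<dots> \<le> R * (scale_factor b * scale_factor d)"
        using scale_factor_drop[OF c(2) cb(2)] scale_factor_ge_1[of d] R
        by (intro mult_left_mono mult_right_mono) auto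
      finally show ?thesis by (simp add: R_def b_def)
    qed
  next
    case False
    then have opp: "z * y m < 0" by simp
    have b: "0 < b" using opp by (auto simp: b_def)
    \<comment> \<open>These are the weights of \<open>pair_bound\<close>, and also the reciprocals
      of the factors in the two available bounds for \<open>F (Suc m) z\<close>. The weighted mean
      of those bounds costs \<open>T powr q \<le> T\<close> and, by Young,
      \<open>(1 / p) powr p * (1 / q) powr q \<le> 2\<close>.\<close>
    define p q where "p = c / (b + c)" and "q = b / (b + c)"
    have pq: "0 < p" "0 < q" "p + q = 1" "q \<le> 1"
      using b c by (auto simp: p_def q_def simp flip: add_divide_distrib)
    have inv: "1 + b / c = 1 / p" "(b + c) / b = 1 / q"
      using b c by (auto simp: p_def q_def field_simps)
    have fz: "F (Suc m) z = F m z * (1 / p)"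
      using F_Suc[OF m(1), of z] opp unfolding inv(1)[symmetric]
      by (auto simp: b_def c_def mult_less_0_iff abs_if field_simps)
    have "F (Suc m) z = F m z * b * ((b + c) / (b * c))"
      unfolding fz inv(1)[symmetric] using b c by (simp add: field_simps)
    also have "\<dots> \<le> T * (F m (y m) * c) * ((b + c) / (b * c))"
      using lz b c by (intro mult_right_mono) auto
    also have "\<dots> = T * F m (y m) * (1 / q)" unfolding inv(2)[symmetric] using c by simp
    finally have fq: "F (Suc m) z \<le> T * F m (y m) * (1 / q)" .
    have "b + c = \<bar>z - y m\<bar>" using opp by (auto simp: b_def c_def mult_less_0_iff abs_if)
    also have "\<dots> \<le> d" using diam Suc.prems(2) y_in[OF m(1)] by blast
    finally have bcd: "b + c \<le> d" .
    have "F (Suc m) z = F (Suc m) z powr p * F (Suc m) z powr q"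
      using pq F_nonneg[of "Suc m" z] by (simp flip: powr_add)
    also have "\<dots> \<le> (F m z * (1 / p)) powr p * (T * F m (y m) * (1 / q)) powr q"
      using fz fq F_nonneg pq by (intro mult_mono powr_mono2) auto
    also have "\<dots> = (F m z powr p * F m (y m) powr q) * (T powr q * ((1 / p) powr p * (1 / q) powr q))"
      using T F_nonneg pq by (simp add: powr_mult powr_divide)
    also have "\<dots> \<le> (T * ((b + c) / \<rho>) powr (9/8) * (scale_factor b * scale_factor c)) * (T * 2)"
    proof (rule mult_mono[OF _ mult_mono])
      show "F m z powr p * F m (y m) powr q \<le> T * ((b + c) / \<rho>) powr (9/8) * (scale_factor b * scale_factor c)"
        using pair_bound[OF m(2) Suc.prems(2) y_in[OF m(1)] opp] c by (simp add: b_def c_def p_def q_def)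
      show "T powr q \<le> T" using T pq powr_mono[of q 1 T] by simp
      show "(1 / p) powr p * (1 / q) powr q \<le> 2"
        using Youngs_inequality_0[of p q "1 / p" "1 / q"] pq by simp
    qed (use T scale_factor_ge_1[of b] scale_factor_ge_1[of c] in auto)
    also have "\<dots> \<le> (T * (d / \<rho>) powr (9/8) * (scale_factor b * scale_factor d)) * (T * 2)"
      using T bcd b c rho cd scale_factor_nonneg
      by (intro mult_right_mono mult_mono mult_left_mono powr_mono2 divide_right_mono scale_factor_mono) auto
    finally show ?thesis by (simp add: b_def power2_eq_square mult_ac)
  qed
qed

lemma final_ratio_bound:
  assumes "z \<in> S"
  shows "F N z \<le> 2 * T\<^sup>2 * (d / \<rho>) powr (9/8 + 2 / lam * ln T)"
proof -
  have "\<bar>z\<bar> \<le> d" using diam[OF assms zero_in] by simp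
  have "F N z \<le> 2 * T\<^sup>2 * (d / \<rho>) powr (9/8) * (scale_factor \<bar>z\<bar> * scale_factor d)"
    using single_bound assms by simp
  also have "\<dots> \<le> 2 * T\<^sup>2 * (d / \<rho>) powr (9/8) * (scale_factor d * scale_factor d)"
    using scale_factor_mono[OF \<open>\<bar>z\<bar> \<le> d\<close>] scale_factor_ge_1[of d]
    by (intro mult_left_mono mult_right_mono) auto
  also have "scale_factor d * scale_factor d = (d / \<rho>) powr (2 / lam * ln T)"
    using rho by (simp add: scale_factor_def max_def flip: powr_add)
  finally show ?thesis by (simp add: powr_add mult_ac)
qed

end

section \<open>The Bernstein--Walsh inequality and separation of nodes\<close>

text \<open>With \<open>c > m\<close> instead of \<open>m\<close> the quotient \<open>|f| exp (- c g)\<close> tends to \<open>0\<close> at infinity and hence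
  attains its maximum, so that no removable singularity argument at infinity is needed.\<close>

lemma bernstein_walsh_strict:
  fixes f :: "complex \<Rightarrow> complex"
  assumes K: "compact K" and g: "regular_green K g" and f: "f holomorphic_on UNIV"
    and growth: "\<forall>\<^sub>F z in at_infinity. cmod (f z) \<le> A * cmod z ^ m"
    and M: "\<And>w. w \<in> K \<Longrightarrow> cmod (f w) \<le> M" and "0 \<le> M" and c: "real m < c"
  shows "cmod (f z) \<le> M * exp (c * g z)"
proof (rule ccontr)
  define h where "h = (\<lambda>z. cmod (f z) * exp (- c * g z))"
  assume "\<not> cmod (f z) \<le> M * exp (c * g z)"
  then have hz: "M < h z" by (simp add: h_def exp_minus field_simps)
  have contg: "continuous_on UNIV g" and gK: "\<And>w. w \<in> K \<Longrightarrow> g w = 0" and harm: "harmonic_on (- K) g"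
    using g by (auto simp: regular_green_def)
  obtain C where C: "\<forall>\<^sub>F z in at_infinity. \<bar>g z - ln (cmod z)\<bar> \<le> C"
    using g by (auto simp: regular_green_def)
  have conth: "continuous_on UNIV h"
    unfolding h_def using holomorphic_on_imp_continuous_on[OF f] contg by (intro continuous_intros)
  \<comment> \<open>This majorant of \<open>h\<close> near infinity comes from the growth of
    \<open>f\<close> and \<open>g \<ge> ln (cmod w) - C\<close>; it decays since
    \<open>m < c\<close>.\<close>
  have "((\<lambda>t::real. \<bar>A\<bar> * exp (c * C) * t powr (real m - c)) \<longlongrightarrow> \<bar>A\<bar> * exp (c * C) * 0) at_top"
    using c by (intro tendsto_intros tendsto_neg_powr filterlim_ident) auto
  then have "((\<lambda>w::complex. \<bar>A\<bar> * exp (c * C) * cmod w powr (real m - c)) \<longlongrightarrow> 0) at_infinity"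
    using filterlim_compose[OF _ filterlim_norm_at_top] by auto
  then have "\<forall>\<^sub>F w in at_infinity. \<bar>A\<bar> * exp (c * C) * cmod w powr (real m - c) < h z"
    using hz \<open>0 \<le> M\<close> by (intro order_tendstoD(2)[where y = 0]) auto
  moreover have "\<forall>\<^sub>F w::complex in at_infinity. 1 \<le> cmod w"
    by (auto simp: eventually_at_infinity)
  ultimately have "\<forall>\<^sub>F w in at_infinity. h w < h z"
    using growth C
  proof eventually_elim
    case (elim w)
    have "0 \<le> c" using c by (smt (verit) of_nat_0_le_iff)
    then have "- c * g w \<le> c * C - c * ln (cmod w)"
      using elim mult_left_mono[of "ln (cmod w) - g w" C c] by (simp add: algebra_simps abs_le_iff)
    then have "h w \<le> (\<bar>A\<bar> * cmod w ^ m) * exp (c * C - c * ln (cmod w))"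
      unfolding h_def using elim
      by (intro mult_mono) (auto intro!: order.trans[OF elim(3)] mult_right_mono)
    also have "\<dots> = \<bar>A\<bar> * exp (c * C) * cmod w powr (real m - c)"
    proof -
      have "cmod w ^ m = exp (real m * ln (cmod w))"
        using elim(2) by (subst exp_of_nat_mult, subst exp_ln) auto
      moreover have "cmod w powr (real m - c) = exp ((real m - c) * ln (cmod w))"
        using elim by (auto simp: powr_def)
      ultimately show ?thesis by (simp add: exp_diff left_diff_distrib)
    qed
    finally show ?case using elim by simp
  qed
  then obtain R where R: "\<And>w. R \<le> cmod w \<Longrightarrow> h w < h z"
    by (auto simp: eventually_at_infinity)
  obtain z1 where z1: "\<And>w. cmod w \<le> max R (cmod z) \<Longrightarrow> h w \<le> h z1"
  proof -
    have "\<exists>y\<in>cball 0 (max R (cmod z)). \<forall>w\<in>cball 0 (max R (cmod z)). h w \<le> h y"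
      using conth by (intro continuous_attains_sup) (auto intro: continuous_on_subset)
    then obtain y where "\<forall>w\<in>cball 0 (max R (cmod z)). h w \<le> h y" by blast
    then show ?thesis by (intro that[of y]) auto
  qed
  have hz1: "h z \<le> h z1" using z1 by simp
  have max: "h w \<le> h z1" for w
    using R[of w] z1[of w] hz1 by (cases "R \<le> cmod w") auto
  \<comment> \<open>The maximum exceeds \<open>M\<close>, so \<open>E\<close> avoids
    \<open>K\<close>, where \<open>h\<close> is at most \<open>M\<close>. Near a point of
    \<open>E\<close> the function \<open>h\<close> is the modulus of a holomorphic function, so it
    is locally constant there; \<open>E\<close> is thus the whole plane, contrary to the
    decay.\<close>
  define E where "E = {w. h w = h z1}"
  have "closed E"
    unfolding E_def using conth by (intro closed_Collect_eq) auto
  moreover have "open E"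
  proof (subst open_contains_ball, intro ballI)
    fix w assume w: "w \<in> E"
    have "h u \<le> M" if "u \<in> K" for u using M[OF that] gK[OF that] by (simp add: h_def)
    then have "w \<in> - K" using w hz hz1 unfolding E_def by fastforce
    then obtain r \<phi> where r: "0 < r" "\<phi> holomorphic_on ball w r" "\<And>u. u \<in> ball w r \<Longrightarrow> g u = Re (\<phi> u)"
      using harm unfolding harmonic_on_def by blast
    define q where "q = (\<lambda>u. f u * exp (- of_real c * \<phi> u))"
    have hq: "cmod (q u) = h u" if "u \<in> ball w r" for u
      using r(3)[OF that] by (simp add: q_def h_def norm_mult)
    have "q constant_on ball w r"
    proof (rule maximum_modulus_principle)
      show "q holomorphic_on ball w r"
        unfolding q_def using r(2) holomorphic_on_subset[OF f] by (intro holomorphic_intros) auto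
      show "cmod (q u) \<le> cmod (q w)" if "u \<in> ball w r" for u
        using hq[OF that] hq[of w] r(1) w max[of u] by (simp add: E_def)
    qed (use r in auto)
    then obtain v where v: "\<And>u. u \<in> ball w r \<Longrightarrow> q u = v" by (auto simp: constant_on_def)
    have "h u = h w" if "u \<in> ball w r" for u
      using hq[OF that] hq[of w] v[OF that] v[of w] r(1) by simp
    then have "ball w r \<subseteq> E" using w by (auto simp: E_def)
    then show "\<exists>e>0. ball w e \<subseteq> E" using r(1) by blast
  qed
  moreover have "z1 \<in> E" by (simp add: E_def)
  ultimately have "E = UNIV" using clopen by blast
  moreover have "of_real \<bar>R\<bar> \<notin> E"
    using R[of "of_real \<bar>R\<bar>"] hz1 abs_ge_self[of R] by (simp add: E_def)
  ultimately show False by simp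
qed

text \<open>The limit of the strict version as \<open>c\<close> decreases to
  \<open>m\<close>.\<close>

lemma bernstein_walsh:
  fixes f :: "complex \<Rightarrow> complex"
  assumes K: "compact K" and g: "regular_green K g" and f: "f holomorphic_on UNIV"
    and growth: "\<forall>\<^sub>F z in at_infinity. cmod (f z) \<le> A * cmod z ^ m"
    and M: "\<And>w. w \<in> K \<Longrightarrow> cmod (f w) \<le> M" and "0 \<le> M"
  shows "cmod (f z) \<le> M * exp (real m * g z)"
proof (rule tendsto_lowerbound)
  show "((\<lambda>c. M * exp (c * g z)) \<longlongrightarrow> M * exp (real m * g z)) (at_right (real m))"
    by (intro tendsto_intros)
  show "\<forall>\<^sub>F c in at_right (real m). cmod (f z) \<le> M * exp (c * g z)"
    using bernstein_walsh_strict[OF assms] by (auto simp: eventually_at_filter)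
qed auto

lemma bernstein_walsh_monic:
  fixes x :: "nat \<Rightarrow> complex"
  assumes K: "compact K" "regular_green K g"
    and M: "\<And>w. w \<in> K \<Longrightarrow> (\<Prod>j<m. cmod (w - x j)) \<le> M" and "0 \<le> M"
  shows "(\<Prod>j<m. cmod (z - x j)) \<le> M * exp (real m * g z)"
proof -
  define f where "f = (\<lambda>w. \<Prod>j<m. w - x j)"
  have norm_f: "cmod (f w) = (\<Prod>j<m. cmod (w - x j))" for w
    by (simp add: f_def prod_norm)
  have "\<forall>\<^sub>F w in at_infinity. \<forall>j\<in>{..<m}. cmod (x j) \<le> cmod w"
    by (intro eventually_ball_finite ballI) (auto simp: eventually_at_infinity)
  then have "\<forall>\<^sub>F w in at_infinity. cmod (f w) \<le> 2 ^ m * cmod w ^ m"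
  proof eventually_elim
    case (elim w)
    have "(\<Prod>j<m. cmod (w - x j)) \<le> (\<Prod>j<m. 2 * cmod w)"
    proof (intro prod_mono conjI)
      fix j assume "j \<in> {..<m}"
      then have "cmod (x j) \<le> cmod w" using elim by blast
      then show "cmod (w - x j) \<le> 2 * cmod w"
        using norm_triangle_ineq4[of w "x j"] by simp
    qed auto
    then show ?case by (simp add: norm_f power_mult_distrib)
  qed
  moreover have "f holomorphic_on UNIV"
    unfolding f_def by (intro holomorphic_intros)
  ultimately show ?thesis
    using bernstein_walsh[OF K, of f "2 ^ m" m M z] M \<open>0 \<le> M\<close> unfolding norm_f by blast
qed

section \<open>Separation of the nodes and size of the diameter\<close>

lemma monic_bdd_above:
  assumes "compact K"
  shows "bdd_above ((\<lambda>w. \<Prod>j<m. cmod (w - x j)) ` K)"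
  using assms by (intro compact_imp_bounded bounded_imp_bdd_above compact_continuous_image continuous_intros)

text \<open>Covers also \<open>m = 0\<close>, outside the range in \<open>quasi_leja\<close>: there
  both products are empty and \<open>\<tau> \<le> 1\<close> suffices.\<close>

lemma quasi_leja_ge:
  assumes "compact K" "quasi_leja K \<tau> x n" "m < n" "w \<in> K" "\<tau> \<le> 1" "0 \<le> \<tau>"
  shows "\<tau> * (\<Prod>j<m. cmod (w - x j)) \<le> (\<Prod>j<m. cmod (x m - x j))"
proof (cases "m = 0")
  case False
  have "\<tau> * (\<Prod>j<m. cmod (w - x j)) \<le> \<tau> * (SUP y\<in>K. \<Prod>j<m. cmod (y - x j))"
    using assms monic_bdd_above[OF assms(1)] by (intro mult_left_mono cSUP_upper) auto
  also have "\<dots> \<le> (\<Prod>j<m. cmod (x m - x j))"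
    using assms False by (auto simp: quasi_leja_def)
  finally show ?thesis .
qed (use assms in simp)

lemma quasi_leja_separation:
  assumes K: "compact K" "regular_green K g" and leja: "quasi_leja K \<tau> x n"
    and tau: "0 < \<tau>" "\<tau> \<le> 1" and delta: "0 < \<delta>"
    and G: "\<And>z. infdist z K \<le> 2 * \<delta> \<Longrightarrow> g z \<le> G" and "0 \<le> G"
    and im: "i < m" "m < n"
  shows "\<tau> * \<delta> * exp (- (real n * G)) \<le> cmod (x m - x i)"
proof (cases "cmod (x m - x i) \<le> \<delta>")
  case True
  define M where "M = (SUP y\<in>K. \<Prod>j<m. cmod (y - x j))"
  have xK: "x j \<in> K" if "j < n" for j using leja that by (simp add: quasi_leja_def)
  have leM: "(\<Prod>j<m. cmod (w - x j)) \<le> M" if "w \<in> K" for w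
    unfolding M_def using monic_bdd_above[OF K(1)] that by (rule cSUP_upper[rotated])
  have "0 \<le> (\<Prod>j<m. cmod (x m - x j))" by (intro prod_nonneg) auto
  then have M0: "0 \<le> M" using leM[OF xK[OF im(2)]] by linarith
  have walsh: "(\<Prod>j<m. cmod (w - x j)) \<le> M * exp (real m * g w)" for w
    using bernstein_walsh_monic[OF K leM M0] .
  \<comment> \<open>\<open>M\<close> is cancelled at the end. If it were 0, the Walsh inequality
    would make the polynomial vanish even away from its zeros.\<close>
  obtain w where "w \<notin> x ` {..<m}"
    using ex_new_if_finite[of "x ` {..<m}"] infinite_UNIV_char_0 by blast
  then have "0 < (\<Prod>j<m. cmod (w - x j))" by (intro prod_pos) auto
  then have M: "0 < M" using walsh[of w] M0 by (cases "M = 0") auto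
  define Q where "Q = (\<lambda>w. \<Prod>j\<in>{..<m} - {i}. w - x j)"
  have factor: "(\<Prod>j<m. cmod (w - x j)) = cmod (w - x i) * cmod (Q w)" for w
    unfolding Q_def using im by (subst prod.remove[of _ i]) (auto simp: prod_norm)
  have "cmod (Q (x m)) \<le> M * exp (real n * G) / \<delta>"
  proof (rule maximum_modulus_frontier[where f = Q and S = "cball (x i) \<delta>"])
    show "Q holomorphic_on interior (cball (x i) \<delta>)" "continuous_on (closure (cball (x i) \<delta>)) Q"
      unfolding Q_def by (intro holomorphic_intros continuous_intros)+
    show "x m \<in> cball (x i) \<delta>" using True by (simp add: dist_norm norm_minus_commute)
    fix w assume "w \<in> frontier (cball (x i) \<delta>)"
    then have w: "cmod (w - x i) = \<delta>" using delta by (simp add: frontier_cball dist_norm norm_minus_commute)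
    have "infdist w K \<le> 2 * \<delta>"
      using infdist_le[OF xK[of i], of w] w im delta by (simp add: dist_norm)
    then have "g w \<le> G" by (rule G)
    then have "real m * g w \<le> real n * G"
      using im \<open>0 \<le> G\<close> by (meson less_imp_le mult_left_mono mult_right_mono of_nat_0_le_iff of_nat_mono order.trans)
    then have "M * exp (real m * g w) \<le> M * exp (real n * G)" using M by simp
    then show "cmod (Q w) \<le> M * exp (real n * G) / \<delta>"
      using walsh[of w] delta unfolding factor w by (simp add: field_simps)
  qed auto
  then have "cmod (x m - x i) * cmod (Q (x m)) \<le> cmod (x m - x i) * (M * exp (real n * G) / \<delta>)"
    by (intro mult_left_mono) auto
  moreover have "\<tau> * M \<le> cmod (x m - x i) * cmod (Q (x m))"
    using leja im unfolding factor[symmetric] M_def by (auto simp: quasi_leja_def)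
  ultimately have "\<tau> * M \<le> cmod (x m - x i) * (M * exp (real n * G) / \<delta>)" by linarith
  then have "M * (\<tau> * \<delta>) \<le> M * (cmod (x m - x i) * exp (real n * G))"
    using delta by (simp add: field_simps)
  then show ?thesis using M by (simp add: exp_minus field_simps)
next
  case False
  have "\<tau> * \<delta> * exp (- (real n * G)) \<le> 1 * \<delta> * 1"
    using tau delta \<open>0 \<le> G\<close> by (intro mult_mono) auto
  then show ?thesis using False by simp
qed

text \<open>Bernstein-Walsh for the linear polynomial with zero \<open>a\<close>, at a point at
  distance \<open>\<delta>\<close> from \<open>a\<close>. It supplies
  \<open>\<rho> \<le> diameter K\<close>.\<close>

lemma diameter_lower_bound:
  assumes K: "compact K" "regular_green K g" "a \<in> K" and delta: "0 < \<delta>"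
    and G: "\<And>z. infdist z K \<le> 2 * \<delta> \<Longrightarrow> g z \<le> G"
  shows "\<delta> * exp (- G) \<le> diameter K"
proof -
  define z where "z = a + of_real \<delta>"
  have za: "cmod (z - a) = \<delta>" using delta by (simp add: z_def)
  have d: "cmod (w - a) \<le> diameter K" if "w \<in> K" for w
    using diameter_bounded_bound[OF compact_imp_bounded[OF K(1)] that K(3)] by (simp add: dist_norm)
  have "\<delta> \<le> diameter K * exp (g z)"
    using bernstein_walsh_monic[OF K(1,2), where m = 1 and x = "\<lambda>_. a" and M = "diameter K" and z = z] d d[OF K(3)] za by simp
  also have "\<dots> \<le> diameter K * exp G"
  proof -
    have "infdist z K \<le> 2 * \<delta>"
      using infdist_le[OF K(3), of z] za delta by (simp add: dist_norm)
    then show ?thesis using G d[OF K(3)] by (intro mult_left_mono) auto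
  qed
  finally show ?thesis by (simp add: exp_minus field_simps)
qed

section \<open>The Lebesgue constant\<close>

lemma cmod_real_diff: "a \<in> \<real> \<Longrightarrow> b \<in> \<real> \<Longrightarrow> cmod (a - b) = \<bar>Re a - Re b\<bar>"
  by (elim Reals_cases) (simp flip: of_real_diff)

lemma lagrange_basis_bound:
  assumes K: "compact K" "K \<subseteq> \<real>" and leja: "quasi_leja K \<tau> x n"
    and tau: "0 < \<tau>" "\<tau> \<le> 1" and lam: "0 < lam" "exp (exp lam) * (exp lam - 1) = 1"
    and rho: "0 < \<rho>" "\<rho> \<le> diameter K"
    and sep: "\<And>i m. i < m \<Longrightarrow> m < n \<Longrightarrow> \<rho> \<le> cmod (x m - x i)"
    and k: "k < n" and w: "w \<in> K"
  shows "cmod (lagrange_basis x n k w) \<le> 2 / \<tau>\<^sup>2 * (diameter K / \<rho>) powr (9/8 + 2 / lam * ln (1 / \<tau>))"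
proof -
  define Y where "Y = (\<lambda>j. Re (x j) - Re (x k))"
  define S where "S = (\<lambda>w. Re w - Re (x k)) ` K"
  \<comment> \<open>For \<open>m = 0\<close> the index set is \<open>{..<k}\<close>, the earlier
    nodes; for \<open>m = N\<close> it is all indices below \<open>n\<close> except
    \<open>k\<close>.\<close>
  define F where "F = (\<lambda>m z. \<Prod>j\<in>{..<k + 1 + m} - {k}. \<bar>z - Y j\<bar> / \<bar>Y j\<bar>)"
  define N where "N = n - 1 - k"
  have xK: "x j \<in> K" if "j < n" for j using leja that by (simp add: quasi_leja_def)
  have cdiff: "cmod (a - b) = \<bar>Re a - Re b\<bar>" if "a \<in> K" "b \<in> K" for a b
    using that K(2) by (intro cmod_real_diff) auto
  have absY: "\<bar>Y j\<bar> = cmod (x k - x j)" if "j < n" for j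
    using cdiff[OF xK[OF k] xK[OF that]] by (simp add: Y_def abs_minus_commute)
  have Y_pos: "0 < \<bar>Y j\<bar>" if "j < n" "j \<noteq> k" for j
    using sep[of j k] sep[of k j] that k rho unfolding absY[OF that(1)]
    by (cases "j < k") (auto simp: norm_minus_commute)
  have num: "\<bar>Re v - Re (x k) - Y j\<bar> = cmod (v - x j)" if "v \<in> K" "j < n" for v j
    using cdiff[OF that(1) xK[OF that(2)]] by (simp add: Y_def)
  define D where "D = (\<lambda>m. \<Prod>j\<in>{..<m} - {k}. \<bar>Y j\<bar>)"
  have D: "0 < D m" if "m \<le> n" for m
    unfolding D_def using that by (intro prod_pos ballI Y_pos) auto
  \<comment> \<open>Multiplying by the distance to \<open>x k\<close> restores the omitted factor,
    so the quasi Leja inequality for the full product applies over the common denominator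
    \<open>D\<close>.\<close>
  have F_mult: "F m (Re v - Re (x k)) * \<bar>Re v - Re (x k)\<bar> = (\<Prod>j<k + 1 + m. cmod (v - x j)) / D (k + 1 + m)"
    if "v \<in> K" "k + 1 + m \<le> n" for v m
  proof -
    have "F m (Re v - Re (x k)) = (\<Prod>j\<in>{..<k + 1 + m} - {k}. cmod (v - x j)) / D (k + 1 + m)"
      unfolding F_def D_def prod_dividef using that num by (intro arg_cong2[where f = "(/)"] prod.cong) auto
    moreover have "(\<Prod>j<k + 1 + m. cmod (v - x j)) = cmod (v - x k) * (\<Prod>j\<in>{..<k + 1 + m} - {k}. cmod (v - x j))"
      by (subst prod.remove[of _ k]) auto
    ultimately show ?thesis using cdiff[OF that(1) xK[OF k]] by simp
  qed
  interpret quasi_leja_ratios S F "\<lambda>m. Y (k + 1 + m)" N "1 / \<tau>" \<rho> "diameter K" lam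
  proof
    show "F 0 z \<le> 1 / \<tau>" if "z \<in> S" for z
    proof -
      from that obtain v where v: "v \<in> K" "z = Re v - Re (x k)" unfolding S_def by blast
      have "{..<k + 1 + 0} - {k} = {..<k}" by auto
      then have "F 0 z = (\<Prod>j<k. cmod (v - x j) / cmod (x k - x j))"
        unfolding F_def v(2) using num[OF v(1)] absY k by (intro prod.cong) auto
      also have "\<dots> = (\<Prod>j<k. cmod (v - x j)) / (\<Prod>j<k. cmod (x k - x j))"
        by (rule prod_dividef)
      also have "\<dots> \<le> 1 / \<tau>"
      proof -
        have "0 < (\<Prod>j<k. cmod (x k - x j))"
          using Y_pos absY k by (intro prod_pos) (metis lessThan_iff less_trans nat_neq_iff)
        then show ?thesis
          using quasi_leja_ge[OF K(1) leja k v(1) tau(2)] tau by (simp add: field_simps)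
      qed
      finally show ?thesis .
    qed
    show "0 \<le> F m z" for m z unfolding F_def by (intro prod_nonneg) auto
    show "F (Suc m) z = F m z * \<bar>1 - z / Y (k + 1 + m)\<bar>" if "m < N" for m z
    proof -
      have "{..<k + 1 + Suc m} - {k} = insert (k + 1 + m) ({..<k + 1 + m} - {k})" by auto
      then have "F (Suc m) z = F m z * (\<bar>z - Y (k + 1 + m)\<bar> / \<bar>Y (k + 1 + m)\<bar>)"
        unfolding F_def by simp
      moreover have "Y (k + 1 + m) \<noteq> 0" using Y_pos[of "k + 1 + m"] that by (auto simp: N_def)
      then have "\<bar>z - Y (k + 1 + m)\<bar> / \<bar>Y (k + 1 + m)\<bar> = \<bar>1 - z / Y (k + 1 + m)\<bar>"
        by (simp add: diff_divide_distrib abs_minus_commute flip: abs_divide)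
      ultimately show ?thesis by (simp only:)
    qed
    show "F m z * \<bar>z\<bar> \<le> 1 / \<tau> * (F m (Y (k + 1 + m)) * \<bar>Y (k + 1 + m)\<bar>)" if "m < N" "z \<in> S" for m z
    proof -
      from that(2) obtain v where v: "v \<in> K" "z = Re v - Re (x k)" unfolding S_def by blast
      have m: "k + 1 + m < n" using that by (simp add: N_def)
      have "F m z * \<bar>z\<bar> = (\<Prod>j<k + 1 + m. cmod (v - x j)) / D (k + 1 + m)"
        unfolding v(2) using F_mult[OF v(1)] m by simp
      also have "\<dots> \<le> 1 / \<tau> * (\<Prod>j<k + 1 + m. cmod (x (k + 1 + m) - x j)) / D (k + 1 + m)"
        using quasi_leja_ge[OF K(1) leja m v(1) tau(2)] tau D[of "k + 1 + m"] m
        by (intro divide_right_mono) (auto simp: field_simps)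
      also have "\<dots> = 1 / \<tau> * (F m (Y (k + 1 + m)) * \<bar>Y (k + 1 + m)\<bar>)"
        using F_mult[OF xK[OF m], of m] m by (simp add: Y_def)
      finally show ?thesis .
    qed
    show "Y (k + 1 + m) \<in> S" if "m < N" for m
      unfolding S_def Y_def using that by (intro imageI xK) (simp add: N_def)
    show "\<rho> \<le> \<bar>Y (k + 1 + m)\<bar>" if "m < N" for m
      using that sep[of k "k + 1 + m"] absY[of "k + 1 + m"] by (simp add: N_def norm_minus_commute)
    show "0 \<in> S" unfolding S_def using xK[OF k] by force
    show "\<bar>u - v\<bar> \<le> diameter K" if uv: "u \<in> S" "v \<in> S" for u v
    proof -
      from uv obtain a b where ab: "a \<in> K" "b \<in> K" "u = Re a - Re (x k)" "v = Re b - Re (x k)"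
        unfolding S_def by blast
      then have "\<bar>u - v\<bar> = dist a b" using cdiff[of a b] by (simp add: dist_norm)
      then show ?thesis using diameter_bounded_bound[OF compact_imp_bounded[OF K(1)]] ab by simp
    qed
  qed (use rho tau lam in auto)
  have "{0..<n} - {k} = {..<k + 1 + N} - {k}" using k by (auto simp: N_def)
  then have "cmod (lagrange_basis x n k w) = F N (Re w - Re (x k))"
    unfolding lagrange_basis_def F_def prod_norm[symmetric] norm_divide
    using num[OF w] absY k by (intro prod.cong) (auto simp: N_def)
  also have "\<dots> \<le> 2 * (1 / \<tau>)\<^sup>2 * (diameter K / \<rho>) powr (9/8 + 2 / lam * ln (1 / \<tau>))"
    using w by (intro final_ratio_bound) (simp add: S_def)
  finally show ?thesis by (simp add: power_divide)
qed

lemma lebesgue_const_le: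
  assumes K: "K \<noteq> {}" and x: "\<And>k. k < n \<Longrightarrow> x k \<in> K"
    and B: "\<And>k w. k < n \<Longrightarrow> w \<in> K \<Longrightarrow> cmod (lagrange_basis x n k w) \<le> B"
  shows "lebesgue_const K x n \<le> real n * B"
  unfolding lebesgue_const_def
proof (intro cSUP_least)
  show "{f. continuous_on K f \<and> (\<forall>y\<in>K. cmod (f y) \<le> 1)} \<noteq> {}"
    by (auto intro!: exI[of _ "\<lambda>_. 0"])
next
  fix f y assume f: "f \<in> {f. continuous_on K f \<and> (\<forall>y\<in>K. cmod (f y) \<le> 1)}" and y: "y \<in> K"
  have "cmod (lagrange_interp x n f y) \<le> (\<Sum>k<n. cmod (f (x k) * lagrange_basis x n k y))"
    unfolding lagrange_interp_def by (rule norm_sum)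
  also have "\<dots> \<le> (\<Sum>k<n. 1 * B)"
    unfolding norm_mult using f x y B by (intro sum_mono mult_mono) auto
  finally show "cmod (lagrange_interp x n f y) \<le> real n * B" by simp
qed (rule K)

theorem theorem2:
  fixes K :: "complex set" and g :: "complex \<Rightarrow> real" and \<tau> \<delta> lam :: real
    and n :: nat and x :: "nat \<Rightarrow> complex"
  assumes "compact K" and "K \<subseteq> \<real>"
    and "regular_green K g"
    and "lam > 0" and "exp (exp lam) * (exp lam - 1) = 1"
    and "0 < \<tau>" and "\<tau> \<le> 1" and "n \<ge> 1"
    and "quasi_leja K \<tau> x n"
    and "\<delta> > 0"
  shows "lebesgue_const K x n \<le>
    2 / \<tau>^2 * real n *
      (diameter K / (\<tau> * \<delta>) * exp (real n * (SUP z\<in>{z. infdist z K \<le> 2 * \<delta>}. g z)))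
        powr (9/8 + 2 / lam * ln (1 / \<tau>))"
proof -
  define G where "G = (SUP z\<in>{z. infdist z K \<le> 2 * \<delta>}. g z)"
  define \<rho> where "\<rho> = \<tau> * \<delta> * exp (- (real n * G))"
  have xK: "x j \<in> K" if "j < n" for j using assms(9) that by (simp add: quasi_leja_def)
  then have x0: "x 0 \<in> K" using assms(8) by simp
  have contg: "continuous_on UNIV g" and "g (x 0) = 0"
    using assms(3) x0 by (auto simp: regular_green_def)
  \<comment> \<open>Compactness and continuity bound \<open>g\<close> there, so the real supremum
    \<open>G\<close> is a genuine upper bound.\<close>
  have "compact {z. infdist z K \<le> 2 * \<delta>}"
    using assms(1,10) x0 by (intro compact_infdist_le) auto
  then have "bdd_above (g ` {z. infdist z K \<le> 2 * \<delta>})"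
    using contg by (intro bounded_imp_bdd_above compact_imp_bounded compact_continuous_image)
      (auto intro: continuous_on_subset)
  then have G: "g z \<le> G" if "infdist z K \<le> 2 * \<delta>" for z
    unfolding G_def using that by (intro cSUP_upper) auto
  have G0: "0 \<le> G" using G[of "x 0"] \<open>g (x 0) = 0\<close> x0 assms(10) by simp
  have rho: "0 < \<rho>" using assms by (simp add: \<rho>_def)
  \<comment> \<open>Here \<open>n \<ge> 1\<close> enters: it weakens \<open>exp (- G)\<close> to
    \<open>exp (- (real n * G))\<close>, placing \<open>\<rho>\<close> below the diameter.\<close>
  have "G \<le> real n * G" using assms(8) G0 by (intro mult_le_cancel_right1[THEN iffD2]) auto
  then have "\<rho> \<le> 1 * \<delta> * exp (- G)"
    unfolding \<rho>_def using assms by (intro mult_mono) auto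
  also have "\<dots> \<le> diameter K"
    using diameter_lower_bound[OF assms(1,3) x0 assms(10) G] by simp
  finally have rho_d: "\<rho> \<le> diameter K" .
  have "cmod (lagrange_basis x n k w) \<le> 2 / \<tau>\<^sup>2 * (diameter K / \<rho>) powr (9/8 + 2 / lam * ln (1 / \<tau>))"
    if "k < n" "w \<in> K" for k w
  proof (rule lagrange_basis_bound)
    show "\<rho> \<le> cmod (x m - x i)" if "i < m" "m < n" for i m
      unfolding \<rho>_def using quasi_leja_separation[OF assms(1,3,9,6,7,10) G G0 that] .
  qed (use assms rho rho_d that in auto)
  then have "lebesgue_const K x n \<le> real n * (2 / \<tau>\<^sup>2 * (diameter K / \<rho>) powr (9/8 + 2 / lam * ln (1 / \<tau>)))"
    using xK x0 by (intro lebesgue_const_le) auto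
  also have "diameter K / \<rho> = diameter K / (\<tau> * \<delta>) * exp (real n * G)"
    by (simp add: \<rho>_def exp_minus field_simps)
  finally show ?thesis by (simp add: G_def mult_ac)
qed

end
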